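(* Let $M_\#\in\mathbb{C}^{n\times n}$ be complex symmetric, $M_\#^T=M_\#$, let $b\in\mathbb{C}^n$ and $j\ge1$. Then there exist a unitary matrix $X\in\mathbb{C}^{n\times n}$ and a diagonal matrix $\Lambda_\#\in\mathbb{C}^{n\times n}$ with $M_\#=X\Lambda_\#\overline{X^{-1}}$, and for any such $X,\Lambda_\#$ and any unitary diagonal matrix $D\in\mathbb{C}^{n\times n}$ satisfying $D^{-1}X^{-1}b\in\mathbb{R}^n$, $$\min_{z\in\mathcal{K}_j(\mathcal{M}_0;b)}\|\mathcal{M}_0z-b\|\le\min_{p\in\mathcal{P}_{j-1}(r2)}\ \max_{\lambda\in\sigma(D_\#)}\left|\lambda\,\overline{p(\lambda)}-1\right|\,\|b\|,$$ where $D_\#=D^{-1}\Lambda_\#\overline{D}$.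
   Context: A bar over a vector or matrix denotes entrywise complex conjugation; $\|\cdot\|$ is the Euclidean norm. $\sigma(D_\#)$ is the usual spectrum, i.e. the set of diagonal entries of $D_\#$. $\mathcal{M}_0:\mathbb{C}^n\to\mathbb{C}^n$ is the antilinear operator $\mathcal{M}_0 z=M_\#\overline{z}$. The Krylov subspace is the complex span $\mathcal{K}_j(\mathcal{M}_0;b)=\mathrm{span}_{\mathbb{C}}\{b,\mathcal{M}_0 b,\ldots,\mathcal{M}_0^{j-1}b\}$. For an integer $j\ge 0$, $\mathcal{P}_j(r2)$ is the set of functions of $\lambda\in\mathbb{C}$ of the form $\sum_{k=0}^{\lfloor j/2\rfloor}(\alpha_{2k}+\alpha_{2k+1}\lambda)|\lambda|^{2k}$ with $\alpha_k\in\mathbb{C}$, where $\alpha_{j+1}=0$ if $j$ is even. *)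

theory Defs
  imports "HOL-Analysis.Analysis"
begin

definition cnj_vec :: "complex ^ 'n \<Rightarrow> complex ^ 'n" where
  "cnj_vec v = (\<chi> i. cnj (v $ i))"

abbreviation cnj_mat :: "complex ^ 'n ^ 'm \<Rightarrow> complex ^ 'n ^ 'm" where
  "cnj_mat A \<equiv> map_matrix cnj A"

definition unitary_mat :: "complex ^ 'n ^ 'n \<Rightarrow> bool" where
  "unitary_mat U \<longleftrightarrow>
     transpose (cnj_mat U) ** U = mat 1 \<and> U ** transpose (cnj_mat U) = mat 1"

definition diagonal_mat :: "complex ^ 'n ^ 'n \<Rightarrow> bool" where
  "diagonal_mat A \<longleftrightarrow> (\<forall>i j. i \<noteq> j \<longrightarrow> A $ i $ j = 0)"

definition real_vec :: "complex ^ 'n \<Rightarrow> bool" where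
  "real_vec v \<longleftrightarrow> (\<forall>i. v $ i \<in> \<real>)"

definition spectrum :: "complex ^ 'n ^ 'n \<Rightarrow> complex set" where
  "spectrum A = {l. \<exists>v. v \<noteq> 0 \<and> A *v v = l *s v}"

lemma spectrum_diagonal_mat:
  assumes "diagonal_mat A"
  shows "spectrum A = range (\<lambda>i. A $ i $ i)"
proof -
  have Av: "(A *v v) $ i = A $ i $ i * v $ i" for v i
  proof -
    have "(A *v v) $ i = (\<Sum>j\<in>UNIV. A $ i $ j * v $ j)"
      by (simp add: matrix_vector_mult_def)
    also have "\<dots> = (\<Sum>j\<in>{i}. A $ i $ j * v $ j)"
      using assms by (intro sum.mono_neutral_right) (auto simp: diagonal_mat_def)
    finally show ?thesis by simp
  qed
  show ?thesis
  proof (intro equalityI subsetI)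
    fix l assume "l \<in> spectrum A"
    then obtain v i where "A *v v = l *s v" "v $ i \<noteq> 0"
      by (auto simp: spectrum_def vec_eq_iff)
    then have "A $ i $ i = l"
      by (metis Av mult_cancel_right vector_smult_component)
    then show "l \<in> range (\<lambda>i. A $ i $ i)" by auto
  next
    fix l assume "l \<in> range (\<lambda>i. A $ i $ i)"
    then obtain i where l: "l = A $ i $ i" by auto
    have "A *v axis i 1 = l *s axis i 1"
      by (simp add: vec_eq_iff Av l axis_def)
    moreover have "axis i (1::complex) \<noteq> 0"
      by (simp add: axis_eq_0_iff)
    ultimately show "l \<in> spectrum A"
      unfolding spectrum_def by blast
  qed
qed

definition antilinear_op :: "complex ^ 'n ^ 'n \<Rightarrow> complex ^ 'n \<Rightarrow> complex ^ 'n" where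
  "antilinear_op M z = M *v cnj_vec z"

text \<open>The span \<open>vec.span\<close> is taken over the field of entries, that is over the complex numbers;
  the constant \<open>span\<close> would give the real span.\<close>

definition krylov :: "nat \<Rightarrow> (complex ^ 'n \<Rightarrow> complex ^ 'n) \<Rightarrow> complex ^ 'n \<Rightarrow> (complex ^ 'n) set" where
  "krylov j T b = vec.span {(T ^^ k) b | k. k < j}"

definition poly_r2 :: "nat \<Rightarrow> (complex \<Rightarrow> complex) set" where
  "poly_r2 j = {p. \<exists>\<alpha> :: nat \<Rightarrow> complex. (even j \<longrightarrow> \<alpha> (j + 1) = 0) \<and>
     p = (\<lambda>l. \<Sum>k\<le>j div 2. (\<alpha> (2 * k) + \<alpha> (2 * k + 1) * l) * of_real (cmod l) ^ (2 * k))}"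

end

theory Submission
  imports Defs
begin

text \<open>For symmetric \<open>M\<close> the antilinear map \<open>z \<mapsto> M *v cnj_vec z\<close> is symmetric for the real inner
  product, so a maximiser of its quadratic form on a unit sphere is an eigenvector with a real
  eigenvalue. Splitting off such vectors one at a time yields a unitary \<open>X\<close>. In the coordinates
  given by \<open>X ** D\<close> the operator is \<open>y \<mapsto> D' *v cnj_vec y\<close> and \<open>b\<close> becomes a real vector \<open>r\<close>; the
  \<open>k\<close>-th iterate of \<open>r\<close> then has the entries \<open>m (D' $ i $ i) * r $ i\<close>, where \<open>m l\<close> is
  \<open>\<bar>l\<bar> ^ k\<close> for even \<open>k\<close> and \<open>l * \<bar>l\<bar> ^ (k - 1)\<close> for odd \<open>k\<close>. So the vectors \<open>p(D') r\<close> with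
  \<open>p\<close> in \<open>poly_r2 (j - 1)\<close> represent elements of the Krylov space, and their residuals can be
  bounded entry by entry.\<close>

section \<open>Symmetric operators on real subspaces\<close>

text \<open>First-order condition: the quadratic vanishes at \<open>t = 0\<close>, so 0 is a minimum
  and the derivative \<open>2 * B\<close> there must be zero.\<close>

lemma linear_le_quadratic_imp_zero:
  fixes B C :: real
  assumes "\<And>t. 0 \<le> 2 * t * B + t\<^sup>2 * C"
  shows "B = 0"
proof -
  have C: "C \<ge> 0" using assms[of 1] assms[of "-1"] by simp
  \<comment> \<open>At \<open>t = - u\<close> the quadratic collapses to
    \<open>- (u\<^sup>2 * (C + 2))\<close>. Dividing by \<open>C + 1\<close> instead of
    \<open>C\<close> also covers \<open>C = 0\<close>.\<close>
  define u where "u = B / (C + 1)"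
  have B: "B = u * (C + 1)" using C by (simp add: u_def)
  have "0 \<le> - (u\<^sup>2 * (C + 2))"
    using assms[of "- u"] by (simp add: B algebra_simps power2_eq_square)
  then have "u\<^sup>2 * (C + 2) \<le> 0" by simp
  then have "u = 0" using C by (simp add: mult_le_0_iff)
  then show ?thesis by (simp add: B)
qed

text \<open>Rayleigh quotient argument: at a maximiser of the form on the unit sphere of
  \<open>W\<close>, the first variation is zero in every direction of \<open>W\<close>, and
  invariance makes the residual \<open>\<sigma> *\<^sub>R v - T v\<close> itself such a
  direction.\<close>

lemma symmetric_operator_eigenvector:
  fixes T :: "'a::euclidean_space \<Rightarrow> 'a"
  assumes lin: "linear T" and sym: "\<And>x y. x \<bullet> T y = y \<bullet> T x"
    and W: "subspace W" and inv: "\<And>w. w \<in> W \<Longrightarrow> T w \<in> W" and ne: "w0 \<in> W" "w0 \<noteq> 0"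
  obtains v \<sigma> where "v \<in> W" "norm v = 1" "T v = \<sigma> *\<^sub>R v"
proof -
  let ?S = "W \<inter> sphere 0 1"
  have "compact ?S" using closed_subspace[OF W] by (simp add: closed_Int_compact)
  moreover have "w0 /\<^sub>R norm w0 \<in> ?S" using ne W by (auto simp: subspace_scale)
  moreover have "continuous_on ?S (\<lambda>w. w \<bullet> T w)"
    using lin by (intro continuous_intros linear_continuous_on)
      (simp add: linear_conv_bounded_linear)
  ultimately obtain v where v: "v \<in> ?S" and mx: "\<And>w. w \<in> ?S \<Longrightarrow> w \<bullet> T w \<le> v \<bullet> T v"
    using continuous_attains_sup[of ?S "\<lambda>w. w \<bullet> T w"] by blast
  define \<sigma> where "\<sigma> = v \<bullet> T v"
  \<comment> \<open>Both sides are homogeneous of degree 2, so the bound passes from the sphere to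
    all of \<open>W\<close>.\<close>
  have F: "w \<bullet> T w \<le> \<sigma> * (w \<bullet> w)" if "w \<in> W" for w
  proof (cases "w = 0")
    case False
    let ?c = "inverse (norm w)"
    have "?c *\<^sub>R w \<in> ?S" using that W False by (auto simp: subspace_scale)
    from mx[OF this] have "?c\<^sup>2 * (w \<bullet> T w) \<le> \<sigma>"
      by (simp add: \<sigma>_def linear_scale[OF lin] power2_eq_square)
    then show ?thesis using False
      by (simp add: power2_norm_eq_inner[symmetric] power_inverse field_simps)
  qed (simp add: linear_0[OF lin])
  have vv: "v \<in> W" "v \<bullet> v = 1" using v by (auto simp: dot_square_norm)
  have orth: "(\<sigma> *\<^sub>R v - T v) \<bullet> w = 0" if w: "w \<in> W" for w
  proof (rule linear_le_quadratic_imp_zero)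
    fix t :: real
    have "v + t *\<^sub>R w \<in> W" using vv w W by (simp add: subspace_add subspace_scale)
    from F[OF this] show "0 \<le> 2 * t * ((\<sigma> *\<^sub>R v - T v) \<bullet> w) + t\<^sup>2 * (\<sigma> * (w \<bullet> w) - w \<bullet> T w)"
      using sym[of v w] vv
      by (simp add: linear_add[OF lin] linear_scale[OF lin] inner_add inner_diff algebra_simps
          power2_eq_square inner_commute \<sigma>_def[symmetric])
  qed
  have "\<sigma> *\<^sub>R v - T v \<in> W" using vv W inv by (simp add: subspace_diff subspace_scale)
  from orth[OF this] have "T v = \<sigma> *\<^sub>R v" by simp
  with v show ?thesis by (intro that) auto
qed

section \<open>Hermitian products and unitary matrices\<close>

text \<open>Conjugate-linear in the first argument. It supplies the complex orthogonality that
  unitarity needs, while its real part is the inner product to which the eigenvector lemma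
  applies.\<close>

definition hdot :: "complex ^ 'n \<Rightarrow> complex ^ 'n \<Rightarrow> complex" where
  "hdot x y = (\<Sum>i\<in>UNIV. cnj (x $ i) * y $ i)"

lemma Re_hdot: "Re (hdot x y) = x \<bullet> y"
  by (simp add: hdot_def inner_vec_def inner_complex_def)

lemma hdot_self: "hdot x x = of_real ((norm x)\<^sup>2)"
proof -
  have "Im (hdot x x) = 0" by (simp add: hdot_def)
  then show ?thesis by (simp add: complex_eq_iff Re_hdot dot_square_norm)
qed

lemma hdot_commute: "hdot y x = cnj (hdot x y)"
  by (simp add: hdot_def mult.commute)

lemma hdot_add_right: "hdot x (y + z) = hdot x y + hdot x z"
  by (simp add: hdot_def sum.distrib algebra_simps)

lemma hdot_scaleR_right: "hdot x (c *\<^sub>R y) = c *\<^sub>R hdot x y"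
  by (simp add: hdot_def scaleR_sum_right)

lemma hdot_zero_right [simp]: "hdot x 0 = 0"
  by (simp add: hdot_def)

text \<open>Both sides are the bilinear form of \<open>M\<close> at the conjugated vectors, so the
  exchange of \<open>x\<close> and \<open>y\<close> involves no conjugation.\<close>

lemma hdot_antilinear_op:
  assumes "transpose M = M"
  shows "hdot x (antilinear_op M y) = hdot y (antilinear_op M x)"
proof -
  have M: "M $ i $ k = M $ k $ i" for i k
    using assms by (metis transpose_def vec_lambda_beta)
  have "hdot x (antilinear_op M y) = (\<Sum>i\<in>UNIV. \<Sum>k\<in>UNIV. cnj (x $ i) * M $ i $ k * cnj (y $ k))"
    by (simp add: hdot_def antilinear_op_def cnj_vec_def matrix_vector_mult_def sum_distrib_left
        mult.assoc)
  also have "\<dots> = (\<Sum>k\<in>UNIV. \<Sum>i\<in>UNIV. cnj (x $ i) * M $ i $ k * cnj (y $ k))"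
    by (rule sum.swap)
  also have "\<dots> = (\<Sum>k\<in>UNIV. \<Sum>i\<in>UNIV. cnj (y $ k) * M $ k $ i * cnj (x $ i))"
    by (intro sum.cong refl) (simp add: M mult_ac)
  also have "\<dots> = hdot y (antilinear_op M x)"
    by (simp add: hdot_def antilinear_op_def cnj_vec_def matrix_vector_mult_def sum_distrib_left
        mult.assoc)
  finally show ?thesis .
qed

text \<open>Linearity here is over the reals, whose scalars are fixed by conjugation.\<close>

lemma linear_antilinear_op: "linear (antilinear_op M)"
  by (rule linearI)
    (simp_all add: antilinear_op_def cnj_vec_def matrix_vector_mult_def vec_eq_iff
      sum.distrib algebra_simps scaleR_sum_right)

lemma matrix_inv_eqI:
  fixes A B :: "'a::field ^ 'n ^ 'n"
  assumes "B ** A = mat 1"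
  shows "matrix_inv A = B"
proof -
  have AB: "A ** B = mat 1" using assms by (rule matrix_left_right_inverse1)
  have "A ** matrix_inv A = mat 1"
    unfolding matrix_inv_def by (rule someI2[of _ B]) (use assms AB in auto)
  then have "B ** (A ** matrix_inv A) = B" by simp
  then show ?thesis by (simp add: matrix_mul_assoc assms)
qed

lemma unitary_matD:
  assumes "unitary_mat U"
  shows "transpose (cnj_mat U) ** U = mat 1" "U ** transpose (cnj_mat U) = mat 1"
    "matrix_inv U = transpose (cnj_mat U)"
  using assms by (auto simp: unitary_mat_def intro: matrix_inv_eqI)

lemma cnj_mat_mult: "cnj_mat (A ** B) = cnj_mat A ** cnj_mat B"
  by (simp add: vec_eq_iff matrix_matrix_mult_def)

lemma cnj_mat_mat_1 [simp]: "cnj_mat (mat 1) = mat 1"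
  by (simp add: vec_eq_iff mat_def)

lemma cnj_mat_transpose: "cnj_mat (transpose A) = transpose (cnj_mat A)"
  by (simp add: vec_eq_iff transpose_def)

lemma cnj_mat_cnj_mat [simp]: "cnj_mat (cnj_mat A) = A"
  by (simp add: vec_eq_iff)

lemma cnj_vec_mult: "cnj_vec (A *v v) = cnj_mat A *v cnj_vec v"
  by (simp add: vec_eq_iff cnj_vec_def matrix_vector_mult_def)

lemma unitary_mat_transpose_cnj:
  assumes "unitary_mat U"
  shows "transpose U ** cnj_mat U = mat 1" "cnj_mat U ** transpose U = mat 1"
  using unitary_matD(1,2)[OF assms, THEN arg_cong, of cnj_mat]
  by (simp_all add: cnj_mat_mult cnj_mat_transpose)

lemma unitary_mat_mult:
  assumes U: "unitary_mat U" and V: "unitary_mat V"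
  shows "unitary_mat (U ** V)"
proof -
  have "transpose (cnj_mat (U ** V)) ** (U ** V)
      = transpose (cnj_mat V) ** (transpose (cnj_mat U) ** U) ** V"
    by (simp add: cnj_mat_mult matrix_transpose_mul matrix_mul_assoc)
  then have "transpose (cnj_mat (U ** V)) ** (U ** V) = mat 1"
    by (simp add: unitary_matD(1)[OF U] unitary_matD(1)[OF V])
  then show ?thesis unfolding unitary_mat_def using matrix_left_right_inverse1 by blast
qed

lemma hdot_mult_left: "hdot (A *v x) y = hdot x (transpose (cnj_mat A) *v y)"
proof -
  have "hdot (A *v x) y = (\<Sum>i\<in>UNIV. \<Sum>k\<in>UNIV. cnj (A $ i $ k) * cnj (x $ k) * y $ i)"
    by (simp add: hdot_def matrix_vector_mult_def sum_distrib_right)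
  also have "\<dots> = (\<Sum>k\<in>UNIV. \<Sum>i\<in>UNIV. cnj (A $ i $ k) * cnj (x $ k) * y $ i)"
    by (rule sum.swap)
  also have "\<dots> = hdot x (transpose (cnj_mat A) *v y)"
    by (simp add: hdot_def matrix_vector_mult_def sum_distrib_left transpose_def mult_ac)
  finally show ?thesis .
qed

lemma norm_unitary_mult:
  assumes "unitary_mat U"
  shows "norm (U *v x) = norm x"
proof -
  have "hdot (U *v x) (U *v x) = hdot x x"
    by (simp add: hdot_mult_left matrix_vector_mul_assoc unitary_matD(1)[OF assms])
  then have "(norm (U *v x))\<^sup>2 = (norm x)\<^sup>2" by (simp only: hdot_self of_real_eq_iff)
  then show ?thesis by simp
qed

lemma diagonal_mat_vec: "diagonal_mat A \<Longrightarrow> (A *v v) $ i = A $ i $ i * v $ i"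
proof -
  assume A: "diagonal_mat A"
  have "(A *v v) $ i = (\<Sum>k\<in>{i}. A $ i $ k * v $ k)"
    unfolding matrix_vector_mult_def vec_lambda_beta
    using A by (intro sum.mono_neutral_right) (auto simp: diagonal_mat_def)
  then show ?thesis by simp
qed

lemma diagonal_mat_mult:
  assumes "diagonal_mat A" "diagonal_mat B"
  shows "diagonal_mat (A ** B)"
  unfolding diagonal_mat_def
proof (intro allI impI)
  fix i j :: 'a assume "i \<noteq> j"
  then have "A $ i $ k * B $ k $ j = 0" for k
    using assms by (cases "k = i") (auto simp: diagonal_mat_def)
  then show "(A ** B) $ i $ j = 0"
    unfolding matrix_matrix_mult_def vec_lambda_beta by (intro sum.neutral ballI)
qed

section \<open>Takagi factorization\<close>

text \<open>The conditions are fewer than the unknowns: written as rows of a square matrix and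
  padded with zero rows outside \<open>A\<close>, they give a singular matrix.\<close>

lemma ex_hdot_orthogonal:
  fixes x :: "'n::finite \<Rightarrow> complex ^ 'n"
  assumes "A \<noteq> UNIV"
  obtains w where "w \<noteq> 0" "\<And>i. i \<in> A \<Longrightarrow> hdot (x i) w = 0"
proof -
  define B :: "complex ^ 'n ^ 'n" where "B = (\<chi> i k. if i \<in> A then cnj (x i $ k) else 0)"
  obtain a where "a \<notin> A" using assms by auto
  then have "row a B = 0" by (simp add: row_def B_def vec_eq_iff)
  then have "\<not> invertible B" using det_zero_row(2) invertible_det_nz by blast
  then obtain w where w: "B *v w = 0" "w \<noteq> 0"
    using matrix_left_invertible_ker[of B] invertible_left_inverse[of B] by auto
  have "hdot (x i) w = (B *v w) $ i" if "i \<in> A" for i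
    using that by (simp add: hdot_def B_def matrix_vector_mult_def)
  with w show ?thesis by (intro that) auto
qed

text \<open>Induction adds one eigenvector at a time, taken from the complex orthogonal complement
  of the earlier ones. Indexing by coordinates makes the case \<open>A = UNIV\<close> a full
  orthonormal basis.\<close>

lemma antilinear_orthonormal_eigenvectors:
  fixes M :: "complex ^ 'n ^ 'n" and A :: "'n set"
  assumes sym: "transpose M = M"
  shows "\<exists>x \<sigma>. (\<forall>i\<in>A. \<forall>k\<in>A. hdot (x i) (x k) = (if i = k then 1 else 0)) \<and>
    (\<forall>i\<in>A. antilinear_op M (x i) = \<sigma> i *\<^sub>R x i)"
proof (induction A rule: finite_induct[OF finite])
  case (2 a A)
  then obtain x \<sigma> where orth: "\<And>i k. i \<in> A \<Longrightarrow> k \<in> A \<Longrightarrow> hdot (x i) (x k) = (if i = k then 1 else 0)"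
    and eig: "\<And>i. i \<in> A \<Longrightarrow> antilinear_op M (x i) = \<sigma> i *\<^sub>R x i" by blast
  define W where "W = {w. \<forall>i\<in>A. hdot (x i) w = 0}"
  obtain w0 where w0: "w0 \<noteq> 0" "w0 \<in> W"
  proof (rule ex_hdot_orthogonal[of A x])
    show "A \<noteq> UNIV" using 2 by blast
  qed (simp add: W_def)
  have W: "subspace W"
    by (auto simp: subspace_def W_def hdot_add_right hdot_scaleR_right)
  \<comment> \<open>By symmetry the product with \<open>x i\<close> moves the operator onto
    \<open>x i\<close>, where it only scales by \<open>\<sigma> i\<close>.\<close>
  have inv: "antilinear_op M w \<in> W" if "w \<in> W" for w
  proof -
    have "hdot (x i) (antilinear_op M w) = 0" if "i \<in> A" for i
      using hdot_antilinear_op[OF sym, of "x i" w] eig[OF that] \<open>w \<in> W\<close> that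
        hdot_commute[of w "x i"]
      by (simp add: hdot_scaleR_right W_def)
    then show ?thesis by (simp add: W_def)
  qed
  have "y \<bullet> antilinear_op M z = z \<bullet> antilinear_op M y" for y z
    using hdot_antilinear_op[OF sym] by (metis Re_hdot)
  from symmetric_operator_eigenvector[OF linear_antilinear_op this W inv w0(2,1)]
  obtain v s where v: "v \<in> W" "norm v = 1" "antilinear_op M v = s *\<^sub>R v" by blast
  have "hdot v v = 1" using v by (simp add: hdot_self)
  moreover have "hdot (x i) v = 0" "hdot v (x i) = 0" if "i \<in> A" for i
    using that v hdot_commute[of v "x i"] by (auto simp: W_def)
  ultimately show ?case using orth eig v 2
    by (intro exI[of _ "x(a := v)"] exI[of _ "\<sigma>(a := s)"]) auto
qed auto

text \<open>With the eigenvectors as columns of \<open>X\<close>, the eigenvalue equations read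
  \<open>M ** cnj_mat X = X ** L\<close>; for unitary \<open>X\<close> the inverse of
  \<open>cnj_mat X\<close> is \<open>transpose X\<close>, which is also
  \<open>cnj_mat (matrix_inv X)\<close>.\<close>

lemma takagi_factorization:
  fixes M :: "complex ^ 'n ^ 'n"
  assumes "transpose M = M"
  obtains X L where "unitary_mat X" "diagonal_mat L" "M = X ** L ** cnj_mat (matrix_inv X)"
proof -
  obtain x :: "'n \<Rightarrow> complex ^ 'n" and \<sigma> where
    orth: "\<And>i k. hdot (x i) (x k) = (if i = k then 1 else 0)"
    and eig: "\<And>i. antilinear_op M (x i) = \<sigma> i *\<^sub>R x i"
    using antilinear_orthonormal_eigenvectors[OF assms, of UNIV] by auto
  define X :: "complex ^ 'n ^ 'n" where "X = (\<chi> r c. x c $ r)"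
  define L :: "complex ^ 'n ^ 'n" where "L = (\<chi> r c. if r = c then of_real (\<sigma> c) else 0)"
  have L: "diagonal_mat L" by (simp add: diagonal_mat_def L_def)
  have "transpose (cnj_mat X) ** X = mat 1"
    using orth by (simp add: vec_eq_iff matrix_matrix_mult_def transpose_def X_def hdot_def mat_def)
  then have X: "unitary_mat X"
    unfolding unitary_mat_def using matrix_left_right_inverse1 by blast
  have "(M ** cnj_mat X) $ r $ c = (X ** L) $ r $ c" for r c
  proof -
    have "(M ** cnj_mat X) $ r $ c = antilinear_op M (x c) $ r"
      by (simp add: matrix_matrix_mult_def antilinear_op_def cnj_vec_def matrix_vector_mult_def X_def)
    also have "\<dots> = \<sigma> c *\<^sub>R x c $ r" by (simp add: eig)
    also have "\<dots> = (X ** L) $ r $ c"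
      by (simp add: matrix_matrix_mult_def L_def X_def if_distrib scaleR_conv_of_real mult.commute
          cong: if_cong)
    finally show ?thesis .
  qed
  then have "M ** cnj_mat X = X ** L" by (simp add: vec_eq_iff)
  then have "X ** L ** transpose X = M ** (cnj_mat X ** transpose X)"
    by (simp add: matrix_mul_assoc)
  then have "M = X ** L ** cnj_mat (matrix_inv X)"
    using X by (simp add: unitary_matD(3) unitary_mat_transpose_cnj(2) cnj_mat_transpose)
  with X L show ?thesis by (rule that)
qed

section \<open>Existence of the two minima\<close>

lemma subspace_complex_span: "subspace (vec.span S :: (complex ^ 'n) set)"
proof -
  have "c *\<^sub>R x = of_real c *s x" for c and x :: "complex ^ 'n"
    by (simp add: vec_eq_iff scaleR_conv_of_real[where 'a = complex])
  then show ?thesis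
    unfolding subspace_def by (simp add: vec.span_zero vec.span_add vec.span_scale)
qed

text \<open>The image is a finite-dimensional subspace, hence closed, and contains a point nearest
  to \<open>b\<close>; any preimage of that point minimises.\<close>

lemma is_arg_min_norm_linear_image:
  fixes T :: "'a::real_vector \<Rightarrow> 'b::euclidean_space"
  assumes "linear T" "subspace S"
  shows "\<exists>z. is_arg_min (\<lambda>z. norm (T z - b)) (\<lambda>z. z \<in> S) z"
proof -
  have "subspace (T ` S)" using assms by (rule linear_subspace_image)
  then have "closed (T ` S)" "T ` S \<noteq> {}" using closed_subspace subspace_0 by auto
  then obtain y where y: "y \<in> T ` S" "\<And>w. w \<in> T ` S \<Longrightarrow> dist b y \<le> dist b w"
    using distance_attains_inf by blast
  then obtain z where "z \<in> S" "y = T z" by blast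
  with y(2) show ?thesis
    by (intro exI[of _ z]) (auto simp: is_arg_min_linorder dist_norm norm_minus_commute[of _ b])
qed

lemma continuous_on_Max_image:
  fixes f :: "'i \<Rightarrow> 'a::topological_space \<Rightarrow> 'b::linorder_topology"
  assumes "finite I" "I \<noteq> {}" "\<And>i. i \<in> I \<Longrightarrow> continuous_on S (f i)"
  shows "continuous_on S (\<lambda>x. Max ((\<lambda>i. f i x) ` I))"
  using assms
proof (induction I rule: finite_ne_induct)
  case (insert i I)
  then show ?case by (auto intro!: continuous_on_max)
qed simp

text \<open>Coercivity: only vectors with deviation at most 1 can beat the vector 0, and these lie
  in a fixed ball, so a minimum over a compact set suffices.\<close>

lemma subspace_attains_max_deviation:
  fixes V :: "(complex ^ 'n) set"
  assumes V: "subspace V"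
  defines "f \<equiv> \<lambda>v :: complex ^ 'n. Max (range (\<lambda>i. cmod (v $ i - 1)))"
  shows "\<exists>v\<in>V. \<forall>w\<in>V. f v \<le> f w"
proof -
  have f_le: "f v \<le> c \<longleftrightarrow> (\<forall>i. cmod (v $ i - 1) \<le> c)" for v c
    by (auto simp: f_def)
  \<comment> \<open>Deviation at most 1 forces entries of modulus at most 2, and the norm is at most
    the sum of the moduli.\<close>
  let ?K = "V \<inter> cball 0 (2 * real CARD('n))"
  have "compact ?K" using closed_subspace[OF V] by (simp add: closed_Int_compact)
  moreover have "continuous_on ?K f"
    unfolding f_def by (intro continuous_on_Max_image continuous_intros) auto
  moreover have 0: "0 \<in> ?K" using V by (simp add: subspace_0)
  ultimately obtain v where v: "v \<in> ?K" and mn: "\<And>w. w \<in> ?K \<Longrightarrow> f v \<le> f w"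
    using continuous_attains_inf[of ?K f] by blast
  have "f v \<le> f w" if w: "w \<in> V" for w
  proof (cases "f w \<le> 1")
    case True
    have "cmod (w $ i) \<le> 2" for i
      using True norm_triangle_ineq[of "w $ i - 1" 1] unfolding f_le
      by (smt (verit) diff_add_cancel norm_one)
    then have "(\<Sum>i\<in>UNIV. cmod (w $ i)) \<le> 2 * real CARD('n)"
      using sum_bounded_above[of UNIV "\<lambda>i. cmod (w $ i)" 2] by (simp add: mult.commute)
    moreover have "norm w \<le> (\<Sum>i\<in>UNIV. cmod (w $ i))"
      by (simp add: norm_vec_def L2_set_le_sum)
    ultimately show ?thesis using w by (intro mn) simp
  next
    case False
    moreover have "f 0 \<le> 1" by (simp add: f_le)
    ultimately show ?thesis using mn[OF 0] by simp
  qed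
  then show ?thesis using v by auto
qed

section \<open>The polynomials \<open>poly_r2\<close>\<close>

text \<open>Enumerates the basis functions behind \<open>poly_r2\<close> by a single index, chosen
  so that index \<open>k\<close> matches the \<open>k\<close>-th iterate of the operator.\<close>

definition r2_monom :: "nat \<Rightarrow> complex \<Rightarrow> complex" where
  "r2_monom k l = (if even k then 1 else l) * of_real (cmod l) ^ (2 * (k div 2))"

text \<open>One application of the antilinear operator to a diagonal entry: from odd
  \<open>k\<close>, \<open>l * cnj l\<close> yields the next factor
  \<open>\<bar>l\<bar>\<^sup>2\<close>; from even \<open>k\<close> the conjugated value is
  real.\<close>

lemma r2_monom_Suc: "r2_monom (Suc k) l = l * cnj (r2_monom k l)"
proof (cases "even k")
  case True
  then show ?thesis by (simp add: r2_monom_def)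
next
  case False
  then obtain m where k: "k = 2 * m + 1" by (rule oddE)
  have "(of_real (cmod l))\<^sup>2 = l * cnj l" by (metis complex_norm_square of_real_power)
  then show ?thesis by (simp add: k r2_monom_def power_mult power2_eq_square mult_ac)
qed

lemma poly_r2_eq: "poly_r2 j = range (\<lambda>c l. \<Sum>k\<le>j. c k * r2_monom k l)"
proof -
  have eq: "(\<lambda>l. \<Sum>k\<le>j div 2. (\<alpha> (2 * k) + \<alpha> (2 * k + 1) * l) * of_real (cmod l) ^ (2 * k))
      = (\<lambda>l. \<Sum>k\<le>j. \<alpha> k * r2_monom k l)" if "even j \<longrightarrow> \<alpha> (j + 1) = 0" for \<alpha> :: "nat \<Rightarrow> complex"
  proof
    fix l
    \<comment> \<open>The unpaired sum ends at \<open>j\<close> for odd \<open>j\<close> but at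
      \<open>j + 1\<close> for even \<open>j\<close>, where the side condition removes the last
      term.\<close>
    have "(\<Sum>k\<le>j div 2. (\<alpha> (2 * k) + \<alpha> (2 * k + 1) * l) * of_real (cmod l) ^ (2 * k))
        = (\<Sum>k\<le>Suc (2 * (j div 2)). \<alpha> k * r2_monom k l)"
      by (simp only: sum.in_pairs_0) (simp add: r2_monom_def algebra_simps)
    also have "\<dots> = (\<Sum>k\<le>j. \<alpha> k * r2_monom k l)"
      using that by (cases "even j") auto
    finally show "(\<Sum>k\<le>j div 2. (\<alpha> (2 * k) + \<alpha> (2 * k + 1) * l) * of_real (cmod l) ^ (2 * k))
        = (\<Sum>k\<le>j. \<alpha> k * r2_monom k l)" .
  qed
  have "(\<lambda>l. \<Sum>k\<le>j. c k * r2_monom k l) \<in> poly_r2 j" for c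
  proof -
    \<comment> \<open>The coefficient at \<open>j + 1\<close> is outside the sum, so resetting it to
      0 meets the side condition without changing the function.\<close>
    have "(\<lambda>l. \<Sum>k\<le>j. c k * r2_monom k l) = (\<lambda>l. \<Sum>k\<le>j. (c(j + 1 := 0)) k * r2_monom k l)"
      by (intro ext sum.cong) auto
    also have "\<dots> \<in> poly_r2 j"
      unfolding poly_r2_def by (intro CollectI exI[of _ "c(j + 1 := 0)"] conjI eq[symmetric]) auto
    finally show ?thesis .
  qed
  then show ?thesis using eq by (auto simp: poly_r2_def)
qed

text \<open>The deviation depends on \<open>p\<close> only through the vector \<open>g p\<close> of
  values \<open>d i * cnj (p (d i))\<close>. These vectors form a real subspace, which reduces the
  claim to the previous minimisation.\<close>

lemma is_arg_min_poly_r2_deviation: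
  fixes d :: "'n::finite \<Rightarrow> complex"
  shows "\<exists>p. is_arg_min (\<lambda>p. Max ((\<lambda>l. cmod (l * cnj (p l) - 1)) ` range d)) (\<lambda>p. p \<in> poly_r2 j) p"
proof -
  define g :: "(complex \<Rightarrow> complex) \<Rightarrow> complex ^ 'n" where "g p = (\<chi> i. d i * cnj (p (d i)))" for p
  have "subspace (g ` poly_r2 j)"
    unfolding subspace_def
  proof (intro conjI ballI allI)
    have "(\<lambda>l. \<Sum>k\<le>j. 0 * r2_monom k l) \<in> poly_r2 j" unfolding poly_r2_eq by (rule rangeI)
    then show "0 \<in> g ` poly_r2 j" by (rule rev_image_eqI) (simp add: g_def vec_eq_iff)
  next
    fix v w assume "v \<in> g ` poly_r2 j" "w \<in> g ` poly_r2 j"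
    then obtain a c where *: "v = g (\<lambda>l. \<Sum>k\<le>j. a k * r2_monom k l)"
      "w = g (\<lambda>l. \<Sum>k\<le>j. c k * r2_monom k l)" unfolding poly_r2_eq by blast
    have "(\<lambda>l. \<Sum>k\<le>j. (a k + c k) * r2_monom k l) \<in> poly_r2 j" unfolding poly_r2_eq by (rule rangeI)
    then show "v + w \<in> g ` poly_r2 j"
      by (rule rev_image_eqI) (simp add: * g_def vec_eq_iff algebra_simps sum.distrib)
  next
    fix t v assume "v \<in> g ` poly_r2 j"
    then obtain a where *: "v = g (\<lambda>l. \<Sum>k\<le>j. a k * r2_monom k l)" unfolding poly_r2_eq by blast
    have "(\<lambda>l. \<Sum>k\<le>j. (of_real t * a k) * r2_monom k l) \<in> poly_r2 j"
      unfolding poly_r2_eq by (rule rangeI)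
    then show "t *\<^sub>R v \<in> g ` poly_r2 j"
      by (rule rev_image_eqI) (simp add: * g_def vec_eq_iff scaleR_conv_of_real[where 'a = complex]
          sum_distrib_left mult_ac)
  qed
  from subspace_attains_max_deviation[OF this] show ?thesis
    by (auto simp: is_arg_min_linorder g_def image_image)
qed

section \<open>The residual bound\<close>

lemma krylov_polynomial_residual:
  fixes D' U :: "complex ^ 'n ^ 'n" and r :: "complex ^ 'n"
  assumes U: "unitary_mat U" and D': "diagonal_mat D'" and r: "real_vec r"
    and p: "p \<in> poly_r2 j"
  defines "M \<equiv> U ** D' ** transpose U"
  obtains z where "z \<in> krylov (Suc j) (antilinear_op M) (U *v r)"
    "norm (antilinear_op M z - U *v r) \<le> Max ((\<lambda>l. cmod (l * cnj (p l) - 1)) ` spectrum D') * norm (U *v r)"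
proof -
  let ?d = "\<lambda>i. D' $ i $ i"
  have r': "cnj (r $ i) = r $ i" for i
    using r by (simp add: real_vec_def Reals_cnj_iff)
  have M: "antilinear_op M (U *v y) = U *v (\<chi> i. ?d i * cnj (y $ i))" for y
  proof -
    have "antilinear_op M (U *v y) = (U ** D' ** (transpose U ** cnj_mat U)) *v cnj_vec y"
      by (simp add: M_def antilinear_op_def cnj_vec_mult matrix_vector_mul_assoc matrix_mul_assoc)
    also have "\<dots> = U *v (D' *v cnj_vec y)"
      by (simp add: unitary_mat_transpose_cnj(1)[OF U] matrix_vector_mul_assoc)
    also have "D' *v cnj_vec y = (\<chi> i. ?d i * cnj (y $ i))"
      by (simp add: vec_eq_iff diagonal_mat_vec[OF D'] cnj_vec_def)
    finally show ?thesis .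
  qed
  have pow: "(antilinear_op M ^^ k) (U *v r) = U *v (\<chi> i. r2_monom k (?d i) * r $ i)" for k
  proof (induction k)
    case 0
    then show ?case by (simp add: r2_monom_def)
  next
    case (Suc k)
    then show ?case by (simp add: M r2_monom_Suc r' mult.assoc)
  qed
  obtain c where c: "p = (\<lambda>l. \<Sum>k\<le>j. c k * r2_monom k l)" using p unfolding poly_r2_eq by blast
  \<comment> \<open>The coefficients of \<open>p\<close> serve as coefficients of the Krylov
    vectors; degree index \<open>j\<close> uses \<open>j + 1\<close> of them, hence
    \<open>Suc j\<close>.\<close>
  define z where "z = (\<Sum>k\<le>j. c k *s (antilinear_op M ^^ k) (U *v r))"
  have zK: "z \<in> krylov (Suc j) (antilinear_op M) (U *v r)"
    unfolding z_def krylov_def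
    by (intro vec.span_sum vec.span_scale vec.span_base) auto
  have "z = U *v (\<chi> i. p (?d i) * r $ i)"
  proof -
    have "(\<chi> i. p (?d i) * r $ i) = (\<Sum>k\<le>j. c k *s (\<chi> i. r2_monom k (?d i) * r $ i))"
      by (simp add: vec_eq_iff c sum_distrib_right mult.assoc)
    then show ?thesis
      by (simp add: z_def pow vec.linear_sum[OF matrix_vector_mul_linear_gen]
          vec.linear_scale[OF matrix_vector_mul_linear_gen])
  qed
  then have "antilinear_op M z - U *v r = U *v ((\<chi> i. ?d i * cnj (p (?d i) * r $ i)) - r)"
    by (simp add: M matrix_vector_mult_diff_distrib)
  \<comment> \<open>Here the realness of \<open>r\<close> matters: \<open>r $ i\<close> survives the
    conjugation and factors out.\<close>
  also have "(\<chi> i. ?d i * cnj (p (?d i) * r $ i)) - r = (\<chi> i. (?d i * cnj (p (?d i)) - 1) * r $ i)"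
    by (simp add: vec_eq_iff r' algebra_simps)
  finally have "antilinear_op M z - U *v r = U *v (\<chi> i. (?d i * cnj (p (?d i)) - 1) * r $ i)" .
  then have "norm (antilinear_op M z - U *v r) = norm (\<chi> i. (?d i * cnj (p (?d i)) - 1) * r $ i)"
    by (simp add: norm_unitary_mult[OF U])
  also have "\<dots> \<le> norm (Max ((\<lambda>l. cmod (l * cnj (p l) - 1)) ` spectrum D') *\<^sub>R r)" (is "_ \<le> norm (?m *\<^sub>R r)")
  proof (rule norm_le_componentwise_cart)
    fix i
    have "cmod (?d i * cnj (p (?d i)) - 1) \<le> ?m"
      by (intro Max_ge) (auto simp: spectrum_diagonal_mat[OF D'])
    then show "norm ((\<chi> i. (?d i * cnj (p (?d i)) - 1) * r $ i) $ i) \<le> norm ((?m *\<^sub>R r) $ i)"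
      by (auto simp: norm_mult intro!: mult_right_mono)
  qed
  also have "\<dots> = ?m * norm (U *v r)"
  proof -
    \<comment> \<open>The scaled norm gives the factor \<open>\<bar>?m\<bar>\<close>; nonnegativity
      of \<open>?m\<close> is read off at an arbitrary index, for which \<open>undefined\<close>
      stands.\<close>
    have "0 \<le> cmod (?d undefined * cnj (p (?d undefined)) - 1)" by simp
    also have "\<dots> \<le> ?m" by (intro Max_ge) (auto simp: spectrum_diagonal_mat[OF D'])
    finally show ?thesis by (simp add: norm_unitary_mult[OF U])
  qed
  finally show ?thesis by (intro that[OF zK])
qed

text \<open>Each minimum is expressed by a minimiser, so attainment is part of the claim. The
  inequality compares \<open>z\<close> with the Krylov vector built from the optimal
  \<open>p\<close>.\<close>

theorem corollary2p6:
  fixes M :: "complex ^ 'n ^ 'n" and b :: "complex ^ 'n" and j :: nat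
  assumes "transpose M = M" and "j \<ge> 1"
  shows "(\<exists>X L. unitary_mat X \<and> diagonal_mat L \<and> M = X ** L ** cnj_mat (matrix_inv X)) \<and>
    (\<forall>X L D :: complex ^ 'n ^ 'n.
       unitary_mat X \<and> diagonal_mat L \<and> M = X ** L ** cnj_mat (matrix_inv X) \<and>
       unitary_mat D \<and> diagonal_mat D \<and> real_vec (matrix_inv D *v (matrix_inv X *v b)) \<longrightarrow>
       (let D' = matrix_inv D ** L ** cnj_mat D;
            res = (\<lambda>z. norm (antilinear_op M z - b));
            dev = (\<lambda>p. Max ((\<lambda>l. cmod (l * cnj (p l) - 1)) ` spectrum D'))
        in \<exists>z p. is_arg_min res (\<lambda>z. z \<in> krylov j (antilinear_op M) b) z \<and>
                 is_arg_min dev (\<lambda>p. p \<in> poly_r2 (j - 1)) p \<and>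
                 res z \<le> dev p * norm b))"
proof (intro conjI allI impI, goal_cases)
  case 1
  then show ?case using takagi_factorization[OF assms(1)] by metis
next
  case (2 X L D)
  then have X: "unitary_mat X" and L: "diagonal_mat L" and factM: "M = X ** L ** cnj_mat (matrix_inv X)"
    and D: "unitary_mat D" "diagonal_mat D" and rr: "real_vec (matrix_inv D *v (matrix_inv X *v b))"
    by auto
  define D' where "D' = matrix_inv D ** L ** cnj_mat D"
  \<comment> \<open>The diagonal phases of \<open>D\<close> are absorbed into the basis, so that
    \<open>b\<close> has the real coordinates \<open>r\<close> and \<open>L\<close> turns into
    \<open>D'\<close>.\<close>
  define U where "U = X ** D"
  define r where "r = matrix_inv D *v (matrix_inv X *v b)"
  define res where "res = (\<lambda>z. norm (antilinear_op M z - b))"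
  define dev where "dev = (\<lambda>p. Max ((\<lambda>l. cmod (l * cnj (p l) - 1)) ` spectrum D'))"
  have U: "unitary_mat U" unfolding U_def using X D by (intro unitary_mat_mult)
  have "diagonal_mat (transpose (cnj_mat D))" "diagonal_mat (cnj_mat D)"
    using D(2) by (auto simp: diagonal_mat_def transpose_def)
  then have D': "diagonal_mat D'"
    using L by (simp add: D'_def unitary_matD(3)[OF D(1)] diagonal_mat_mult)
  have "r = transpose (cnj_mat U) *v b"
    by (simp only: r_def U_def unitary_matD(3)[OF D(1)] unitary_matD(3)[OF X] cnj_mat_mult
        matrix_transpose_mul matrix_vector_mul_assoc)
  then have b: "b = U *v r"
    by (simp only: matrix_vector_mul_assoc unitary_matD(2)[OF U] matrix_vector_mul_lid)
  \<comment> \<open>The factors \<open>D\<close> cancel on both sides of \<open>L\<close>: on the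
    left by unitarity of \<open>D\<close>, on the right by its conjugate form.\<close>
  have "U ** D' ** transpose U
      = X ** (D ** transpose (cnj_mat D)) ** L ** (cnj_mat D ** transpose D) ** transpose X"
    by (simp add: U_def D'_def unitary_matD(3)[OF D(1)] matrix_transpose_mul matrix_mul_assoc)
  also have "\<dots> = M"
    by (simp add: unitary_matD(2)[OF D(1)] unitary_mat_transpose_cnj(2)[OF D(1)] factM
        unitary_matD(3)[OF X] cnj_mat_transpose)
  finally have M: "U ** D' ** transpose U = M" .
  have "subspace (krylov j (antilinear_op M) b)"
    unfolding krylov_def by (rule subspace_complex_span)
  then obtain z where z: "is_arg_min res (\<lambda>z. z \<in> krylov j (antilinear_op M) b) z"
    unfolding res_def using is_arg_min_norm_linear_image[OF linear_antilinear_op] by blast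
  obtain p where p: "is_arg_min dev (\<lambda>p. p \<in> poly_r2 (j - 1)) p"
    unfolding dev_def spectrum_diagonal_mat[OF D'] using is_arg_min_poly_r2_deviation by blast
  have "p \<in> poly_r2 (j - 1)" using p by (simp add: is_arg_min_def)
  from krylov_polynomial_residual[OF U D' rr[folded r_def] this]
  obtain y where "y \<in> krylov (Suc (j - 1)) (antilinear_op M) b" "res y \<le> dev p * norm b"
    unfolding M b[symmetric] res_def dev_def by metis
  \<comment> \<open>With truncated subtraction this needs \<open>j \<ge> 1\<close>; it matches the
    degree index to the Krylov dimension index.\<close>
  moreover have "Suc (j - 1) = j" using assms(2) by simp
  ultimately have "res z \<le> dev p * norm b"
    using z by (force simp: is_arg_min_linorder)
  with z p have "\<exists>z p. is_arg_min res (\<lambda>z. z \<in> krylov j (antilinear_op M) b) z \<and>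
      is_arg_min dev (\<lambda>p. p \<in> poly_r2 (j - 1)) p \<and> res z \<le> dev p * norm b" by blast
  then show ?case unfolding Let_def res_def dev_def D'_def .
qed

end
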